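(* Let $W\in\mathbb{N}$, $\alpha\in(0,1)$, $c>1/4$, let $\mu\in[0,1]^W$ and let $m\in[0,1]^W$ with $m\ne\mu$. Let $\mathcal{I}(m)=\{a\in[W]:m_a\ne\mu_a\}$. Assume that the sampling scheme $(\pi_t)$ satisfies: almost surely, there exists $a\in\mathcal{I}(m)$ (possibly depending on the realization of the data) such that $N_t(a)=\sum_{i=1}^t\mathbf{1}[A_i=a]\to\infty$ as $t\to\infty$. (This is assumed under every choice of arm distributions $P\in\mathcal{P}(\mu)$.) Then $T_t(m,\alpha)$ is a test of power one: $$\inf_{P\in\mathcal{P}(\mu)}P\big(\exists t<\infty:\ T_t(m,\alpha)=1\big)=1 .$$
   Context: $[W]=\{1,\dots,W\}$ indexes the arms. $\mathcal{P}(\mu)$ denotes the set of tuples $P=(P_1,\dots,P_W)$ of probability distributions on $[0,1]$ such that $P_a$ has mean $\mu_a$ for each $a$. Data are collected sequentially: with $\mathcal{F}_{t}=\sigma((A_i,X_i)_{i=1}^{t})$ ($\mathcal F_0$ trivial), a sampling scheme is a sequence $(\pi_t)$ of $\mathcal{F}_{t-1}$-measurable elements of the probability simplex over $[W]$; at time $t$, $A_t$ is drawn from $\pi_t$ given $\mathcal{F}_{t-1}$, and given $\mathcal{F}_{t-1}$ and $A_t=a$ the outcome $X_t$ is drawn from $P_a$; $P(\cdot)$ is the resulting probability. Let $N_t(a)=\sum_{i=1}^t\mathbf{1}[A_i=a]$ and $\hat\mu_t(a)=\frac{1}{N_t(a)}\sum_{i=1}^t\mathbf{1}[A_i=a]X_i$;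 if $N_t(a)=0$, set $\hat\mu_t(a)=m_a$. For $m\in[0,1]^W$, $$K_t^a(m_a)=\prod_{i=1}^t\left(1-\mathbf{1}[A_i=a]+\mathbf{1}[A_i=a]\left(1+\frac{(\hat\mu_{i-1}(a)-m_a)(X_i-m_a)}{c}\right)\right),\qquad E_t(m)=\frac1W\sum_{a\in[W]}K_t^a(m_a),$$ and $T_t(m,\alpha)=\mathbf{1}\left[\max_{1\le i\le t}E_i(m)\ge1/\alpha\right]$. *)

theory Defs
  imports "HOL-Probability.Probability"
begin

text \<open>
  The arms are the elements of a finite type \<open>'w\<close>, so that $W$ is \<open>CARD('w)\<close>, and a
  distribution over arms is a \<open>'w pmf\<close>.
  The data live on the canonical space of sequences \<open>\<omega> :: nat \<Rightarrow> 'w \<times> real\<close>. Coordinates start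
  at 0 while time starts at 1: coordinate \<open>n\<close> of \<open>\<omega>\<close> is the observation $(A_{n+1}, X_{n+1})$.
\<close>

type_synonym 'w path = "nat \<Rightarrow> 'w \<times> real"

abbreviation obs_space :: "('w::finite \<times> real) measure" where
  "obs_space \<equiv> count_space UNIV \<Otimes>\<^sub>M borel"

abbreviation history_space :: "nat \<Rightarrow> 'w::finite path measure" where
  "history_space n \<equiv> PiM {0..<n} (\<lambda>_. obs_space)"

definition arm_dists :: "real ^ 'w \<Rightarrow> ('w::finite \<Rightarrow> real measure) set" where
  "arm_dists \<mu> = {P. \<forall>a. prob_space (P a) \<and> sets (P a) = sets borel \<and>
     emeasure (P a) {0..1} = 1 \<and> (\<integral>x. x \<partial>P a) = \<mu> $ a}"

text \<open>
  Measurability of $\pi_t$ with respect to $\mathcal{F}_{t-1}$, for $t = n + 1$: the scheme is a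
  measurable function of the first \<open>n\<close> observations.
\<close>

definition sampling_scheme :: "(nat \<Rightarrow> 'w::finite path \<Rightarrow> 'w pmf) \<Rightarrow> bool" where
  "sampling_scheme \<pi> \<longleftrightarrow>
     (\<forall>n a. (\<lambda>h. pmf (\<pi> (Suc n) h) a) \<in> borel_measurable (history_space n))"

text \<open>The conditional law of $(A_{n+1}, X_{n+1})$ given the history \<open>h\<close> of the first \<open>n\<close> observations.\<close>

definition step_law ::
  "(nat \<Rightarrow> 'w::finite path \<Rightarrow> 'w pmf) \<Rightarrow> ('w \<Rightarrow> real measure) \<Rightarrow>
   nat \<Rightarrow> 'w path \<Rightarrow> ('w \<times> real) measure" where
  "step_law \<pi> P n h =
     measure_pmf (\<pi> (Suc n) h) \<bind> (\<lambda>a. P a \<bind> (\<lambda>x. return obs_space (a, x)))"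

definition data_law ::
  "(nat \<Rightarrow> 'w::finite path \<Rightarrow> 'w pmf) \<Rightarrow> ('w \<Rightarrow> real measure) \<Rightarrow> 'w path measure" where
  "data_law \<pi> P =
     projective_family.lim UNIV (Ionescu_Tulcea.CI (step_law \<pi> P) (\<lambda>_. obs_space)) (\<lambda>_. obs_space)"

definition arm :: "nat \<Rightarrow> 'w path \<Rightarrow> 'w" where
  "arm t \<omega> = fst (\<omega> (t - 1))"

definition outcome :: "nat \<Rightarrow> 'w path \<Rightarrow> real" where
  "outcome t \<omega> = snd (\<omega> (t - 1))"

definition pulls :: "nat \<Rightarrow> 'w \<Rightarrow> 'w path \<Rightarrow> nat" where
  "pulls t a \<omega> = (\<Sum>i=1..t. of_bool (arm i \<omega> = a))"

definition mean_est :: "real ^ 'w \<Rightarrow> nat \<Rightarrow> 'w::finite \<Rightarrow> 'w path \<Rightarrow> real" where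
  "mean_est m t a \<omega> =
     (if pulls t a \<omega> = 0 then m $ a
      else (\<Sum>i=1..t. of_bool (arm i \<omega> = a) * outcome i \<omega>) / real (pulls t a \<omega>))"

definition arm_wealth :: "real \<Rightarrow> real ^ 'w \<Rightarrow> nat \<Rightarrow> 'w::finite \<Rightarrow> 'w path \<Rightarrow> real" where
  "arm_wealth c m t a \<omega> =
     (\<Prod>i=1..t. 1 - of_bool (arm i \<omega> = a) + of_bool (arm i \<omega> = a) *
        (1 + (mean_est m (i - 1) a \<omega> - m $ a) * (outcome i \<omega> - m $ a) / c))"

definition e_process :: "real \<Rightarrow> real ^ 'w \<Rightarrow> nat \<Rightarrow> 'w::finite path \<Rightarrow> real" where
  "e_process c m t \<omega> = 1 / real CARD('w) * (\<Sum>a\<in>UNIV. arm_wealth c m t a \<omega>)"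

text \<open>Only meaningful for \<open>t \<ge> 1\<close>, where the maximum is over a nonempty set.\<close>

definition seq_test :: "real \<Rightarrow> real ^ 'w \<Rightarrow> real \<Rightarrow> nat \<Rightarrow> 'w::finite path \<Rightarrow> nat" where
  "seq_test c m \<alpha> t \<omega> = of_bool (Max ((\<lambda>i. e_process c m i \<omega>) ` {1..t}) \<ge> 1 / \<alpha>)"

text \<open>
  For a sampling scheme and arm distributions, \<open>step_law\<close> is a family of probability kernels, so
  \<open>data_law\<close> is a probability measure on the sequence space and is the law with these kernels as
  conditional distributions.
\<close>

lemma Ionescu_Tulcea_step_law:
  fixes \<pi> :: "nat \<Rightarrow> 'w::finite path \<Rightarrow> 'w pmf"
  assumes \<pi>: "sampling_scheme \<pi>" and P: "P \<in> arm_dists \<mu>"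
  shows "Ionescu_Tulcea (step_law \<pi> P) (\<lambda>_. obs_space)"
proof -
  have sP: "sets (P a) = sets borel" and pP: "prob_space (P a)" for a
    using P by (auto simp: arm_dists_def)
  have P_sub: "P \<in> measurable (count_space UNIV) (subprob_algebra borel)"
    using sP pP by (auto simp: space_subprob_algebra intro: prob_space_imp_subprob_space)
  have kern: "(\<lambda>a. P a \<bind> (\<lambda>x. return obs_space (a, x)))
    \<in> measurable (count_space UNIV) (subprob_algebra obs_space)"
    by (rule measurable_bind[OF P_sub]) measurable
  have pk: "prob_space (P a \<bind> (\<lambda>x. return obs_space (a, x)))" for a
  proof (rule prob_space.prob_space_bind[OF pP, where S = obs_space])
    have "(\<lambda>x. return obs_space (a, x)) \<in> measurable borel (subprob_algebra obs_space)"
      by measurable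
    thus "(\<lambda>x. return obs_space (a, x)) \<in> measurable (P a) (subprob_algebra obs_space)"
      using measurable_cong_sets[OF sP refl] by blast
  qed (auto intro!: AE_I2 prob_space_return simp: space_pair_measure)
  have m: "step_law \<pi> P n \<in> measurable (history_space n) (subprob_algebra obs_space)" for n
    unfolding step_law_def
  proof (rule measurable_bind2)
    show "(\<lambda>h. measure_pmf (\<pi> (Suc n) h)) \<in>
      measurable (history_space n) (subprob_algebra (count_space UNIV))"
    proof (rule measurable_subprob_algebra)
      fix A :: "'w set"
      have "(\<lambda>h. emeasure (measure_pmf (\<pi> (Suc n) h)) A) = (\<lambda>h. ennreal (\<Sum>a\<in>A. pmf (\<pi> (Suc n) h) a))"
        by (simp add: emeasure_measure_pmf_finite)
      moreover have "(\<lambda>h. pmf (\<pi> (Suc n) h) a) \<in> borel_measurable (history_space n)" for a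
        using \<pi> by (auto simp: sampling_scheme_def)
      ultimately show "(\<lambda>h. emeasure (measure_pmf (\<pi> (Suc n) h)) A) \<in> borel_measurable (history_space n)"
        by simp
    qed (auto simp: prob_space_imp_subprob_space measure_pmf.prob_space_axioms)
  qed (rule kern)
  have p: "prob_space (step_law \<pi> P n h)" for n h
    unfolding step_law_def
  proof (rule prob_space.prob_space_bind[where S = obs_space])
    show "prob_space (measure_pmf (\<pi> (Suc n) h))" by (rule measure_pmf.prob_space_axioms)
    show "(\<lambda>a. P a \<bind> (\<lambda>x. return obs_space (a, x)))
      \<in> measurable (measure_pmf (\<pi> (Suc n) h)) (subprob_algebra obs_space)"
      using kern measurable_cong_sets[of "measure_pmf (\<pi> (Suc n) h)" "count_space UNIV"] by force
  qed (simp add: pk)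
  show ?thesis unfolding Ionescu_Tulcea_def using m p by blast
qed

lemma
  fixes \<pi> :: "nat \<Rightarrow> 'w::finite path \<Rightarrow> 'w pmf"
  assumes "sampling_scheme \<pi>" "P \<in> arm_dists \<mu>"
  shows prob_space_data_law: "prob_space (data_law \<pi> P)"
    and sets_data_law: "sets (data_law \<pi> P) = sets (PiM UNIV (\<lambda>_. obs_space))"
    and distr_data_law_Suc:
      "distr (data_law \<pi> P) (history_space (Suc n)) (\<lambda>\<omega>. restrict \<omega> {0..<Suc n}) =
       distr (data_law \<pi> P) (history_space n) (\<lambda>\<omega>. restrict \<omega> {0..<n}) \<bind>
         (\<lambda>h. distr (step_law \<pi> P n h) (history_space (Suc n)) (\<lambda>z. h(n := z)))"
proof -
  interpret IT: Ionescu_Tulcea "step_law \<pi> P" "\<lambda>_. obs_space"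
    using assms by (rule Ionescu_Tulcea_step_law)
  have law: "data_law \<pi> P = IT.PF.lim" by (simp add: data_law_def)
  show sets: "sets (data_law \<pi> P) = sets (PiM UNIV (\<lambda>_. obs_space))"
    by (simp add: law)
  have up: "IT.up_to {0..<k} = k" for k :: nat
    using IT.up_to_iff_Ico[of "{0..<k}" k] IT.up_to[of "{0..<k}"]
    by (cases k) (auto simp: IT.up_to_def)
  have marg: "distr (data_law \<pi> P) (history_space k) (\<lambda>\<omega>. restrict \<omega> {0..<k}) =
      IT.C 0 k (\<lambda>_. undefined)" for k
  proof -
    have "IT.CI {0..<k} = IT.C 0 k (\<lambda>_. undefined)"
      using IT.distr_C[of k k "\<lambda>_. undefined" 0] by (simp add: IT.CI_def up)
    thus ?thesis by (simp add: law IT.distr_lim)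
  qed
  have "prob_space (distr (data_law \<pi> P) (history_space 0) (\<lambda>\<omega>. restrict \<omega> {0..<0}))"
    unfolding marg by (rule IT.prob_space_C) simp
  thus "prob_space (data_law \<pi> P)"
    by (rule prob_space_distrD[rotated])
       (auto intro!: measurable_restrict measurable_component_singleton
             simp: measurable_cong_sets[OF sets refl])
  show "distr (data_law \<pi> P) (history_space (Suc n)) (\<lambda>\<omega>. restrict \<omega> {0..<Suc n}) =
       distr (data_law \<pi> P) (history_space n) (\<lambda>\<omega>. restrict \<omega> {0..<n}) \<bind>
         (\<lambda>h. distr (step_law \<pi> P n h) (history_space (Suc n)) (\<lambda>z. h(n := z)))"
    unfolding marg by (simp add: IT.eP_def[abs_def])
qed

end

(* For |\<theta>| <= 1/2 the wealth of the constant bet \<theta> on the centred outcomes of an arm is a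
   nonnegative martingale, hence almost surely bounded by Ville's inequality. Since
   ln (1 + x) >= x - 2 x^2 for |x| <= 1/2, the centred sum over N pulls is at most k/\<theta> + 2 \<theta> N,
   and \<theta> -> 0 gives a strong law of large numbers for adaptively sampled arms. Everything else is
   pathwise: ln (1 + (u - m) (x - m) / c) lies above its chord in x, which is affine in the outcome,
   so the strong law bounds the growth rate of the log-wealth from below by that of the limiting bet
   against a Bernoulli arm; this rate is positive because m (1 - m) <= 1/4 < c. *)

theory Submission
  imports Defs
begin

section \<open>Integration against the law of the data\<close>

lemma measurable_restrict_data_law:
  fixes \<pi> :: "nat \<Rightarrow> 'w::finite path \<Rightarrow> 'w pmf"
  assumes "sampling_scheme \<pi>" "P \<in> arm_dists \<mu>"
  shows "(\<lambda>\<omega>. restrict \<omega> {0..<n}) \<in> measurable (data_law \<pi> P) (history_space n)"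
  by (auto intro!: measurable_restrict measurable_component_singleton
      simp: measurable_cong_sets[OF sets_data_law[OF assms] refl])

text \<open>Tower property, obtained by integrating \<open>G\<close> over both sides of
  \<open>distr_data_law_Suc\<close>. The later proofs take expectations one step further in this
  form.\<close>

lemma nn_integral_data_law_Suc:
  fixes \<pi> :: "nat \<Rightarrow> 'w::finite path \<Rightarrow> 'w pmf"
  assumes \<pi>: "sampling_scheme \<pi>" and P: "P \<in> arm_dists \<mu>"
    and G[measurable]: "G \<in> borel_measurable (history_space (Suc n))"
  shows "(\<integral>\<^sup>+\<omega>. G (restrict \<omega> {0..<Suc n}) \<partial>data_law \<pi> P) =
    (\<integral>\<^sup>+\<omega>. (\<integral>\<^sup>+z. G ((restrict \<omega> {0..<n})(n := z)) \<partial>step_law \<pi> P n (restrict \<omega> {0..<n})) \<partial>data_law \<pi> P)"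
proof -
  interpret IT: Ionescu_Tulcea "step_law \<pi> P" "\<lambda>_. obs_space"
    using \<pi> P by (rule Ionescu_Tulcea_step_law)
  let ?M = "\<lambda>k. distr (data_law \<pi> P) (history_space k) (\<lambda>\<omega>. restrict \<omega> {0..<k})"
  let ?K = "\<lambda>h. distr (step_law \<pi> P n h) (history_space (Suc n)) (\<lambda>z. h(n := z))"
  note r = measurable_restrict_data_law[OF \<pi> P]
  have K: "?K \<in> measurable (history_space n) (subprob_algebra (history_space (Suc n)))"
    using IT.measurable_eP[of n] unfolding IT.eP_def[abs_def] by simp
  have sl: "sets (step_law \<pi> P n h) = sets obs_space" if "h \<in> space (history_space n)" for h
    using IT.P[of n] that by (rule sets_kernel)
  have upd: "(\<lambda>z. h(n := z)) \<in> measurable (step_law \<pi> P n h) (history_space (Suc n))"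
    if "h \<in> space (history_space n)" for h
  proof -
    have "(\<lambda>z. h(n := z)) \<in> measurable obs_space (PiM (insert n {0..<n}) (\<lambda>_. obs_space))"
      using that by (intro measurable_fun_upd[where J="{0..<n}"]) auto
    then show ?thesis
      using measurable_cong_sets[OF sl[OF that] refl] by (metis atLeast0_lessThan_Suc)
  qed
  \<comment> \<open>The history \<open>h\<close> occurs both in the integrand and in the measure.
    Pushing forward along \<open>h(n := z)\<close> moves it entirely into the kernel
    \<open>?K\<close>, whose measurability is known.\<close>
  have inner: "(\<lambda>h. (\<integral>\<^sup>+z. G (h(n := z)) \<partial>step_law \<pi> P n h)) \<in> borel_measurable (history_space n)"
  proof -
    have "(\<lambda>h. \<integral>\<^sup>+g. G g \<partial>?K h) \<in> borel_measurable (history_space n)"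
      using K by (intro nn_integral_measurable_subprob_algebra2[where N="history_space (Suc n)"]) auto
    also have "?this \<longleftrightarrow> (\<lambda>h. (\<integral>\<^sup>+z. G (h(n := z)) \<partial>step_law \<pi> P n h)) \<in> borel_measurable (history_space n)"
      by (rule measurable_cong) (simp add: nn_integral_distr upd)
    finally show ?thesis .
  qed
  have "(\<integral>\<^sup>+\<omega>. G (restrict \<omega> {0..<Suc n}) \<partial>data_law \<pi> P) = (\<integral>\<^sup>+h. G h \<partial>?M (Suc n))"
    by (simp add: nn_integral_distr[OF r])
  also have "\<dots> = (\<integral>\<^sup>+h. G h \<partial>(?M n \<bind> ?K))"
    by (simp only: distr_data_law_Suc[OF \<pi> P])
  also have "\<dots> = (\<integral>\<^sup>+h. (\<integral>\<^sup>+g. G g \<partial>?K h) \<partial>?M n)"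
    by (rule nn_integral_bind[OF G]) (use K in simp)
  also have "\<dots> = (\<integral>\<^sup>+h. (\<integral>\<^sup>+z. G (h(n := z)) \<partial>step_law \<pi> P n h) \<partial>?M n)"
    by (rule nn_integral_cong) (simp add: nn_integral_distr upd)
  also have "\<dots> = (\<integral>\<^sup>+\<omega>. (\<integral>\<^sup>+z. G ((restrict \<omega> {0..<n})(n := z)) \<partial>step_law \<pi> P n (restrict \<omega> {0..<n})) \<partial>data_law \<pi> P)"
    by (rule nn_integral_distr[OF r]) (use inner in simp)
  finally show ?thesis .
qed

lemma nn_integral_step_law:
  fixes \<pi> :: "nat \<Rightarrow> 'w::finite path \<Rightarrow> 'w pmf"
  assumes P: "P \<in> arm_dists \<mu>" and f[measurable]: "f \<in> borel_measurable obs_space"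
  shows "(\<integral>\<^sup>+z. f z \<partial>step_law \<pi> P n h) = (\<integral>\<^sup>+a. (\<integral>\<^sup>+x. f (a, x) \<partial>P a) \<partial>measure_pmf (\<pi> (Suc n) h))"
proof -
  have sP[measurable_cong]: "sets (P a) = sets borel" and pP: "prob_space (P a)" for a
    using P by (auto simp: arm_dists_def)
  have P_sub: "P \<in> measurable (count_space UNIV) (subprob_algebra borel)"
    using sP pP by (auto simp: space_subprob_algebra intro: prob_space_imp_subprob_space)
  have kern: "(\<lambda>a. P a \<bind> (\<lambda>x. return obs_space (a, x)))
    \<in> measurable (count_space UNIV) (subprob_algebra obs_space)"
    by (rule measurable_bind[OF P_sub]) measurable
  have ret: "(\<lambda>x. return obs_space (a, x)) \<in> measurable (P a) (subprob_algebra obs_space)" for a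
    by measurable
  have inner: "(\<integral>\<^sup>+z. f z \<partial>(P a \<bind> (\<lambda>x. return obs_space (a, x)))) = (\<integral>\<^sup>+x. f (a, x) \<partial>P a)" for a :: 'w
    by (subst nn_integral_bind[OF f ret]) (simp add: nn_integral_return space_pair_measure)
  have "(\<integral>\<^sup>+z. f z \<partial>step_law \<pi> P n h) =
      (\<integral>\<^sup>+a. (\<integral>\<^sup>+z. f z \<partial>(P a \<bind> (\<lambda>x. return obs_space (a, x)))) \<partial>measure_pmf (\<pi> (Suc n) h))"
    unfolding step_law_def by (rule nn_integral_bind[OF f]) (use kern in simp)
  then show ?thesis by (simp add: inner)
qed

text \<open>Whichever arm the scheme picks, the indicator of the complement of the unit interval
  integrates to zero. Later pathwise estimates can therefore treat all outcomes of a fixed path as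
  bounded.\<close>

lemma AE_outcomes_in_unit:
  fixes \<pi> :: "nat \<Rightarrow> 'w::finite path \<Rightarrow> 'w pmf"
  assumes \<pi>: "sampling_scheme \<pi>" and P: "P \<in> arm_dists \<mu>"
  shows "AE \<omega> in data_law \<pi> P. \<forall>n. snd (\<omega> n) \<in> {0..1}"
proof -
  note [measurable_cong] = sets_data_law[OF \<pi> P]
  define f :: "'w \<times> real \<Rightarrow> ennreal" where "f z = indicator (- {0..1}) (snd z)" for z
  have f[measurable]: "f \<in> borel_measurable obs_space"
    unfolding f_def by measurable
  have fP: "(\<integral>\<^sup>+x. f (a, x) \<partial>P a) = 0" for a
  proof -
    have sP: "sets (P a) = sets borel" and p: "prob_space (P a)" and e: "emeasure (P a) {0..1} = 1"
      using P by (auto simp: arm_dists_def)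
    interpret prob_space "P a" by fact
    have "AE x in P a. x \<in> {0..1}"
      using e sP by (intro AE_in_set_eq_1[THEN iffD2]) (auto simp: emeasure_eq_measure)
    then have "AE x in P a. f (a, x) = 0"
      by eventually_elim (auto simp: f_def)
    then show ?thesis
      by (subst nn_integral_cong_AE[where v="\<lambda>_. 0"]) auto
  qed
  have "AE \<omega> in data_law \<pi> P. snd (\<omega> n) \<in> {0..1}" for n
  proof -
    have "(\<integral>\<^sup>+\<omega>. f (restrict \<omega> {0..<Suc n} n) \<partial>data_law \<pi> P) = 0"
      by (subst nn_integral_data_law_Suc[OF \<pi> P, where G="\<lambda>h. f (h n)"])
         (simp_all add: nn_integral_step_law[OF P] fP)
    then have "AE \<omega> in data_law \<pi> P. f (\<omega> n) = 0"
      by (subst (asm) nn_integral_0_iff_AE) auto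
    then show ?thesis
      by eventually_elim (auto simp: f_def indicator_def split: if_splits)
  qed
  then show ?thesis by (subst AE_all_countable) blast
qed

section \<open>Maximal inequality for nonnegative supermartingales\<close>

text \<open>Ville's inequality: capping the process at \<open>B\<close> from its first passage above \<open>B\<close> on keeps it
  a supermartingale, so no stopping time is needed.\<close>

lemma ville_data_law:
  fixes \<pi> :: "nat \<Rightarrow> 'w::finite path \<Rightarrow> 'w pmf" and H :: "nat \<Rightarrow> 'w path \<Rightarrow> ennreal"
  assumes \<pi>: "sampling_scheme \<pi>" and P: "P \<in> arm_dists \<mu>"
    and H: "\<And>n. H n \<in> borel_measurable (history_space n)"
    and super: "\<And>n h. h \<in> space (history_space n) \<Longrightarrow>
      (\<integral>\<^sup>+z. H (Suc n) (h(n := z)) \<partial>step_law \<pi> P n h) \<le> H n h"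
    and H0: "\<And>h. H 0 h \<le> 1"
  shows "B * emeasure (data_law \<pi> P)
    {\<omega> \<in> space (data_law \<pi> P). \<exists>n. B \<le> H n (restrict \<omega> {0..<n})} \<le> 1"
proof -
  interpret prob_space "data_law \<pi> P" by (rule prob_space_data_law[OF \<pi> P])
  interpret IT: Ionescu_Tulcea "step_law \<pi> P" "\<lambda>_. obs_space"
    using \<pi> P by (rule Ionescu_Tulcea_step_law)
  note r[measurable] = measurable_restrict_data_law[OF \<pi> P]
  note [measurable] = H
  \<comment> \<open>\<open>U n\<close> records a passage at any time up to \<open>n\<close>. It
    depends on the first \<open>n\<close> observations only, so the capped process \<open>H'\<close>
    stays adapted.\<close>
  define U where "U n h \<longleftrightarrow> (\<exists>k\<in>{..n}. B \<le> H k (restrict h {0..<k}))" for n and h :: "'w path"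
  define H' where "H' n h = (if U n h then B else H n h)" for n h
  have res: "(\<lambda>h. restrict h {0..<k}) \<in> measurable (history_space n) (history_space k)" if "k \<le> n" for k n
    using that by (intro measurable_restrict_subset) auto
  have U[measurable]: "Measurable.pred (history_space n) (U n)" for n
    unfolding U_def
  proof (rule pred_intros_finite)
    fix k assume "k \<in> {..n}"
    then have [measurable]: "(\<lambda>h. H k (restrict h {0..<k})) \<in> borel_measurable (history_space n)"
      using measurable_comp[OF res H] by (auto simp: comp_def)
    show "Measurable.pred (history_space n) (\<lambda>h. B \<le> H k (restrict h {0..<k}))"
      by measurable
  qed simp
  have H'[measurable]: "H' n \<in> borel_measurable (history_space n)" for n
    unfolding H'_def by measurable
  have super': "(\<integral>\<^sup>+z. H' (Suc n) (h(n := z)) \<partial>step_law \<pi> P n h) \<le> H' n h"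
    if h: "h \<in> space (history_space n)" for n h
  proof -
    interpret S: prob_space "step_law \<pi> P n h" using h by (rule IT.prob_space_P)
    have rk: "restrict (h(n := z)) {0..<k} = restrict h {0..<k}" if "k \<le> n" for z k
      using that by (auto simp: restrict_def)
    \<comment> \<open>Points of \<open>history_space n\<close> are \<open>undefined\<close> outside
      the first \<open>n\<close> coordinates, so this restriction changes nothing.\<close>
    have hn': "restrict (h(n := z)) {0..<Suc n} = h(n := z)" for z
    proof
      fix k
      have "k \<notin> {0..<n} \<Longrightarrow> h k = undefined"
        using h unfolding space_PiM by (rule PiE_arb)
      then show "restrict (h(n := z)) {0..<Suc n} k = (h(n := z)) k"
        by (cases "k < n"; cases "k = n") simp_all
    qed
    show ?thesis
    proof (cases "U n h")
      \<comment> \<open>After passage the capped process is frozen at \<open>B\<close>, and the step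
        law has mass one.\<close>
      case True
      then obtain k where k: "k \<le> n" "B \<le> H k (restrict h {0..<k})"
        unfolding U_def by blast
      have "U (Suc n) (h(n := z))" for z
        unfolding U_def
      proof (rule bexI[of _ k])
        show "B \<le> H k (restrict (h(n := z)) {0..<k})"
          using k(2) unfolding rk[OF k(1)] .
      qed (use k(1) in simp)
      then show ?thesis using True by (simp add: H'_def S.emeasure_space_1)
    next
      case False
      have "H' (Suc n) (h(n := z)) \<le> H (Suc n) (h(n := z))" for z
      proof (cases "U (Suc n) (h(n := z))")
        case True
        then obtain k where k: "k \<le> Suc n" "B \<le> H k (restrict (h(n := z)) {0..<k})"
          unfolding U_def by blast
        \<comment> \<open>No passage occurred up to \<open>n\<close>, so this is the first one.
          There \<open>H\<close> is at least \<open>B\<close>, and capping only lowers the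
          value.\<close>
        have "k = Suc n"
        proof (rule ccontr)
          assume "k \<noteq> Suc n"
          then have "k \<le> n" using k(1) by simp
          then have "U n h"
            unfolding U_def using k(2) rk[OF \<open>k \<le> n\<close>] by (intro bexI[of _ k]) simp_all
          with False show False ..
        qed
        then have "B \<le> H (Suc n) (h(n := z))" using k(2) by (simp only: hn')
        then show ?thesis using True by (simp only: H'_def if_True)
      qed (simp only: H'_def if_False order_refl)
      then have "(\<integral>\<^sup>+z. H' (Suc n) (h(n := z)) \<partial>step_law \<pi> P n h) \<le>
          (\<integral>\<^sup>+z. H (Suc n) (h(n := z)) \<partial>step_law \<pi> P n h)"
        by (intro nn_integral_mono)
      also have "\<dots> \<le> H n h" by (rule super[OF h])
      finally show ?thesis using False by (simp add: H'_def)
    qed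
  qed
  have bound: "(\<integral>\<^sup>+\<omega>. H' n (restrict \<omega> {0..<n}) \<partial>data_law \<pi> P) \<le> 1" for n
  proof (induction n)
    case 0
    have "H' 0 (restrict \<omega> {0..<0}) \<le> 1" for \<omega>
      using H0[of "restrict \<omega> {0..<0}"] by (auto simp: H'_def U_def intro: order_trans)
    then have "(\<integral>\<^sup>+\<omega>. H' 0 (restrict \<omega> {0..<0}) \<partial>data_law \<pi> P) \<le> (\<integral>\<^sup>+\<omega>. 1 \<partial>data_law \<pi> P)"
      by (intro nn_integral_mono)
    then show ?case by (simp only: nn_integral_const emeasure_space_1 mult_1)
  next
    case (Suc n)
    have "(\<integral>\<^sup>+\<omega>. H' (Suc n) (restrict \<omega> {0..<Suc n}) \<partial>data_law \<pi> P) \<le>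
        (\<integral>\<^sup>+\<omega>. H' n (restrict \<omega> {0..<n}) \<partial>data_law \<pi> P)"
      unfolding nn_integral_data_law_Suc[OF \<pi> P H']
      by (intro nn_integral_mono super' measurable_space[OF r])
    with Suc show ?case by (rule order_trans[rotated])
  qed
  define V where "V n = {\<omega> \<in> space (data_law \<pi> P). U n (restrict \<omega> {0..<n})}" for n
  have V[measurable]: "V n \<in> sets (data_law \<pi> P)" for n
    unfolding V_def by measurable
  have Veq: "U n (restrict \<omega> {0..<n}) \<longleftrightarrow> (\<exists>k\<le>n. B \<le> H k (restrict \<omega> {0..<k}))" for n \<omega>
    unfolding U_def by (auto simp: Int_absorb1 ivl_subset)
  \<comment> \<open>Markov's inequality: the capped process equals \<open>B\<close> on
    \<open>V n\<close>.\<close>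
  have VB: "B * emeasure (data_law \<pi> P) (V n) \<le> 1" for n
  proof -
    have "B * emeasure (data_law \<pi> P) (V n) = (\<integral>\<^sup>+\<omega>. B * indicator (V n) \<omega> \<partial>data_law \<pi> P)"
      by (simp add: nn_integral_cmult_indicator)
    also have "\<dots> \<le> (\<integral>\<^sup>+\<omega>. H' n (restrict \<omega> {0..<n}) \<partial>data_law \<pi> P)"
      by (intro nn_integral_mono) (auto simp: V_def H'_def indicator_def)
    finally show ?thesis using bound[of n] by simp
  qed
  have "incseq V"
    unfolding V_def Veq by (auto simp: incseq_def intro: order_trans)
  then have "emeasure (data_law \<pi> P) (\<Union>n. V n) = (SUP n. emeasure (data_law \<pi> P) (V n))"
    by (intro SUP_emeasure_incseq[symmetric]) auto
  moreover have "(\<Union>n. V n) = {\<omega> \<in> space (data_law \<pi> P). \<exists>n. B \<le> H n (restrict \<omega> {0..<n})}"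
    unfolding V_def Veq by auto
  ultimately show ?thesis
    using VB by (simp add: SUP_mult_left_ennreal SUP_le_iff)
qed

text \<open>A path on which no natural number is a strict upper bound lies in \<open>X B\<close> for
  every \<open>B\<close>. By Ville's inequality \<open>B\<close> times the probability of that
  intersection is at most 1 for all \<open>B\<close>, which forces probability zero.\<close>

lemma AE_supermartingale_bounded:
  fixes \<pi> :: "nat \<Rightarrow> 'w::finite path \<Rightarrow> 'w pmf" and H :: "nat \<Rightarrow> 'w path \<Rightarrow> ennreal"
  assumes \<pi>: "sampling_scheme \<pi>" and P: "P \<in> arm_dists \<mu>"
    and H[measurable]: "\<And>n. H n \<in> borel_measurable (history_space n)"
    and super: "\<And>n h. h \<in> space (history_space n) \<Longrightarrow>
      (\<integral>\<^sup>+z. H (Suc n) (h(n := z)) \<partial>step_law \<pi> P n h) \<le> H n h"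
    and H0: "\<And>h. H 0 h \<le> 1"
  shows "AE \<omega> in data_law \<pi> P. \<exists>B::nat. \<forall>n. H n (restrict \<omega> {0..<n}) < of_nat B"
proof -
  interpret prob_space "data_law \<pi> P" by (rule prob_space_data_law[OF \<pi> P])
  note r[measurable] = measurable_restrict_data_law[OF \<pi> P]
  define X where "X B = {\<omega> \<in> space (data_law \<pi> P). \<exists>n. of_nat B \<le> H n (restrict \<omega> {0..<n})}" for B :: nat
  have X[measurable]: "X B \<in> sets (data_law \<pi> P)" for B
    unfolding X_def by measurable
  have le: "of_nat B * prob (\<Inter>B. X B) \<le> 1" for B
  proof -
    have "prob (\<Inter>B. X B) \<le> prob (X B)"
      by (intro finite_measure_mono) auto
    moreover have "ennreal (of_nat B * prob (X B)) \<le> 1"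
      using ville_data_law[OF \<pi> P H super H0, of "of_nat B"]
      unfolding X_def[symmetric]
      by (simp add: emeasure_eq_measure ennreal_mult ennreal_of_nat_eq_real_of_nat)
    ultimately show ?thesis
      by (simp add: ennreal_le_1) (meson mult_left_mono of_nat_0_le_iff order_trans)
  qed
  have "prob (\<Inter>B. X B) = 0"
  proof (rule ccontr)
    assume "prob (\<Inter>B. X B) \<noteq> 0"
    then have "0 < prob (\<Inter>B. X B)" by (simp add: zero_less_measure_iff)
    then obtain B where "1 < of_nat B * prob (\<Inter>B. X B)"
      using reals_Archimedean3 by blast
    with le[of B] show False by simp
  qed
  then have "AE \<omega> in data_law \<pi> P. \<omega> \<notin> (\<Inter>B. X B)"
    by (intro AE_not_in) (auto simp: null_sets_def emeasure_eq_measure)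
  then show ?thesis
    using AE_space by eventually_elim (auto simp: X_def not_le)
qed

section \<open>Strong law of large numbers for an adaptively sampled arm\<close>

text \<open>Each factor integrates to one under every arm: under \<open>a\<close> because the
  outcome is centred at its mean, under the others because the factor is 1. The product is thus a
  martingale whatever the scheme does.\<close>

lemma AE_bet_bounded:
  fixes \<pi> :: "nat \<Rightarrow> 'w::finite path \<Rightarrow> 'w pmf" and \<mu> :: "real ^ 'w"
  assumes \<pi>: "sampling_scheme \<pi>" and P: "P \<in> arm_dists \<mu>" and \<theta>: "\<bar>\<theta>\<bar> \<le> 1 / 2"
    and \<mu>: "\<mu> $ a \<in> {0..1}"
  shows "AE \<omega> in data_law \<pi> P. \<exists>B::nat. \<forall>n.
    (\<Prod>i<n. ennreal (1 + \<theta> * (of_bool (fst (\<omega> i) = a) * (snd (\<omega> i) - \<mu> $ a)))) < of_nat B"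
proof -
  define f where "f z = ennreal (1 + \<theta> * (of_bool (fst z = a) * (snd z - \<mu> $ a)))" for z :: "'w \<times> real"
  define H where "H n h = (\<Prod>i\<in>{0..<n}. f (h i))" for n and h :: "'w path"
  have f[measurable]: "f \<in> borel_measurable obs_space"
    unfolding f_def by measurable
  have one: "(\<integral>\<^sup>+x. f (b, x) \<partial>P b) = 1" for b :: 'w
  proof -
    have sP[measurable_cong]: "sets (P b) = sets borel" and p: "prob_space (P b)"
      and e: "emeasure (P b) {0..1} = 1" and m: "(\<integral>x. x \<partial>P b) = \<mu> $ b"
      using P by (auto simp: arm_dists_def)
    interpret prob_space "P b" by fact
    have u: "AE x in P b. x \<in> {0..1}"
      using e sP by (intro AE_in_set_eq_1[THEN iffD2]) (auto simp: emeasure_eq_measure)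
    show ?thesis
    proof (cases "a = b")
      case True
      have int: "integrable (P b) (\<lambda>x. x)"
        using u by (intro integrable_const_bound[where B=1]) (auto elim: eventually_mono)
      \<comment> \<open>\<open>ennreal\<close> sends negative numbers to 0, so the factor must be
        almost surely nonnegative before its integral can be computed as a real one.\<close>
      have "AE x in P b. 0 \<le> 1 + \<theta> * (x - \<mu> $ a)"
        using u
      proof eventually_elim
        case (elim x)
        then have "\<bar>\<theta> * (x - \<mu> $ a)\<bar> \<le> (1/2) * 1"
          using \<theta> \<mu> unfolding abs_mult by (intro mult_mono) auto
        then show ?case by linarith
      qed
      then have "(\<integral>\<^sup>+x. f (b, x) \<partial>P b) = ennreal (\<integral>x. 1 + \<theta> * (x - \<mu> $ a) \<partial>P b)"
        using int by (subst nn_integral_eq_integral[symmetric]) (auto simp: f_def True)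
      also have "(\<integral>x. 1 + \<theta> * (x - \<mu> $ a) \<partial>P b) = 1"
        using int m True by (simp add: prob_space)
      finally show ?thesis by simp
    qed (auto simp: f_def emeasure_space_1)
  qed
  have H[measurable]: "H n \<in> borel_measurable (history_space n)" for n
    unfolding H_def by measurable
  have super: "(\<integral>\<^sup>+z. H (Suc n) (h(n := z)) \<partial>step_law \<pi> P n h) \<le> H n h"
    if "h \<in> space (history_space n)" for n h
  proof -
    have "H (Suc n) (h(n := z)) = H n h * f z" for z
      by (simp add: H_def mult.commute)
    then have "(\<integral>\<^sup>+z. H (Suc n) (h(n := z)) \<partial>step_law \<pi> P n h) = (\<integral>\<^sup>+z. H n h * f z \<partial>step_law \<pi> P n h)"
      by simp
    also have "\<dots> = H n h"
    proof -
      have fb: "(\<lambda>x. f (b, x)) \<in> borel_measurable (P b)" for b :: 'w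
      proof -
        have [measurable_cong]: "sets (P b) = sets borel" using P by (auto simp: arm_dists_def)
        show ?thesis by measurable
      qed
      show ?thesis
        by (simp add: nn_integral_step_law[OF P] nn_integral_cmult[OF fb] one)
    qed
    finally show ?thesis by simp
  qed
  have "AE \<omega> in data_law \<pi> P. \<exists>B::nat. \<forall>n. H n (restrict \<omega> {0..<n}) < of_nat B"
    by (rule AE_supermartingale_bounded[OF \<pi> P H super]) (auto simp: H_def)
  then show ?thesis
    by (simp add: H_def f_def atLeast0LessThan)
qed

lemma pulls_eq_sum: "real (pulls t a \<omega>) = (\<Sum>i<t. of_bool (fst (\<omega> i) = a))"
  by (simp add: pulls_def arm_def sum.atLeast1_atMost_eq)

text \<open>Take logarithms of the product bound and use
  \<open>ln (1 + x) \<ge> x - 2 * x\<^sup>2\<close> for each factor. Squares are replaced by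
  \<open>b i\<close> so that, with \<open>b\<close> the indicator of a pull, the error term counts
  pulls.\<close>

lemma sum_prod_bounded_bets:
  fixes y :: "nat \<Rightarrow> real"
  assumes \<theta>: "\<bar>\<theta>\<bar> \<le> 1 / 2" and y: "\<And>i. \<bar>y i\<bar> \<le> 1" and yb: "\<And>i. (y i)\<^sup>2 \<le> b i"
    and B: "(\<Prod>i<n. ennreal (1 + \<theta> * y i)) < of_nat B"
  shows "\<theta> * (\<Sum>i<n. y i) \<le> ln (real B) + 2 * \<theta>\<^sup>2 * (\<Sum>i<n. b i)"
proof -
  have small: "\<bar>\<theta> * y i\<bar> \<le> 1 / 2" for i
    using mult_mono[OF \<theta> y[of i]] by (simp add: abs_mult)
  have pos: "0 < 1 + \<theta> * y i" for i
    using small[of i] by linarith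
  have low: "\<theta> * y i - 2 * \<theta>\<^sup>2 * b i \<le> ln (1 + \<theta> * y i)" for i
  proof -
    have "\<bar>ln (1 + \<theta> * y i) - \<theta> * y i\<bar> \<le> 2 * (\<theta> * y i)\<^sup>2"
      by (rule abs_ln_one_plus_x_minus_x_bound[OF small])
    moreover have "2 * (\<theta> * y i)\<^sup>2 \<le> 2 * \<theta>\<^sup>2 * b i"
      using yb[of i] by (simp add: power_mult_distrib mult_left_mono)
    ultimately show ?thesis by linarith
  qed
  have "ennreal (\<Prod>i<n. 1 + \<theta> * y i) < ennreal (real B)"
    using B pos by (simp add: prod_ennreal less_imp_le ennreal_of_nat_eq_real_of_nat)
  then have less: "(\<Prod>i<n. 1 + \<theta> * y i) < real B"
    by (simp add: ennreal_less_iff prod_nonneg pos less_imp_le)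
  have "(\<Sum>i<n. \<theta> * y i - 2 * \<theta>\<^sup>2 * b i) \<le> (\<Sum>i<n. ln (1 + \<theta> * y i))"
    by (intro sum_mono low)
  also have "\<dots> = ln (\<Prod>i<n. 1 + \<theta> * y i)"
    using pos by (simp add: ln_prod less_imp_neq[symmetric])
  also have "\<dots> \<le> ln (real B)"
    using less prod_pos[of "{..<n}" "\<lambda>i. 1 + \<theta> * y i"] pos by (intro ln_mono) auto
  finally show ?thesis
    by (simp add: sum_subtractf flip: sum_distrib_left)
qed

text \<open>Betting with both signs of \<theta> controls the sum from both sides. Only countably
  many slopes are treated, so one null set serves all \<open>j\<close>; the constant
  \<open>k\<close> may depend on the path and on \<open>j\<close>, but not on
  \<open>n\<close>.\<close>

lemma AE_centred_sum_bound:
  fixes \<pi> :: "nat \<Rightarrow> 'w::finite path \<Rightarrow> 'w pmf" and \<mu> :: "real ^ 'w"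
  assumes \<pi>: "sampling_scheme \<pi>" and P: "P \<in> arm_dists \<mu>" and \<mu>: "\<mu> $ a \<in> {0..1}"
  shows "AE \<omega> in data_law \<pi> P. \<forall>j::nat. \<exists>k. \<forall>n.
    \<bar>\<Sum>i<n. of_bool (fst (\<omega> i) = a) * (snd (\<omega> i) - \<mu> $ a)\<bar> \<le> k + real (pulls n a \<omega>) / (real j + 1)"
proof (subst AE_all_countable, rule allI)
  fix j :: nat
  \<comment> \<open>Dividing the logarithmic bound by \<theta> leaves slope
    \<open>2 * \<theta>\<close>, which this choice makes equal to
    \<open>1 / (real j + 1)\<close>.\<close>
  define \<theta> where "\<theta> = 1 / (2 * (real j + 1))"
  have \<theta>0: "0 < \<theta>" by (simp add: \<theta>_def)
  have "\<theta> \<le> 1 / 2" by (simp add: \<theta>_def divide_simps)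
  then have \<theta>1: "\<bar>\<theta>\<bar> \<le> 1 / 2" and \<theta>2: "\<bar>-\<theta>\<bar> \<le> 1 / 2" using \<theta>0 by auto
  show "AE \<omega> in data_law \<pi> P. \<exists>k. \<forall>n.
    \<bar>\<Sum>i<n. of_bool (fst (\<omega> i) = a) * (snd (\<omega> i) - \<mu> $ a)\<bar> \<le> k + real (pulls n a \<omega>) / (real j + 1)"
    using AE_bet_bounded[OF \<pi> P \<theta>1 \<mu>] AE_bet_bounded[OF \<pi> P \<theta>2 \<mu>] AE_outcomes_in_unit[OF \<pi> P]
  proof eventually_elim
    case (elim \<omega>)
    define y where "y i = of_bool (fst (\<omega> i) = a) * (snd (\<omega> i) - \<mu> $ a)" for i
    define b :: "nat \<Rightarrow> real" where "b i = of_bool (fst (\<omega> i) = a)" for i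
    have y: "\<bar>y i\<bar> \<le> 1" for i
      using elim(3)[rule_format, of i] \<mu> by (auto simp: y_def)
    have yb: "(y i)\<^sup>2 \<le> b i" for i
      using y[of i] abs_le_square_iff[of "y i" 1] by (auto simp: y_def b_def)
    obtain B1 B2 :: nat where
      B1: "\<And>n. (\<Prod>i<n. ennreal (1 + \<theta> * y i)) < of_nat B1" and
      B2: "\<And>n. (\<Prod>i<n. ennreal (1 + (-\<theta>) * y i)) < of_nat B2"
      using elim(1,2) by (auto simp: y_def)
    define k where "k = max (ln (real B1)) (ln (real B2)) / \<theta>"
    have "\<bar>\<Sum>i<n. y i\<bar> \<le> k + real (pulls n a \<omega>) / (real j + 1)" for n
    proof -
      have N: "(\<Sum>i<n. b i) = real (pulls n a \<omega>)"
        by (simp add: pulls_eq_sum b_def)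
      have "\<theta> * \<bar>\<Sum>i<n. y i\<bar> \<le> max (ln (real B1)) (ln (real B2)) + 2 * \<theta>\<^sup>2 * (\<Sum>i<n. b i)"
        using sum_prod_bounded_bets[OF \<theta>1 y yb B1, of n] sum_prod_bounded_bets[OF \<theta>2 y yb B2, of n]
        by (auto simp: abs_if)
      then have "\<bar>\<Sum>i<n. y i\<bar> \<le> (max (ln (real B1)) (ln (real B2)) + 2 * \<theta>\<^sup>2 * (\<Sum>i<n. b i)) / \<theta>"
        using \<theta>0 by (simp add: pos_le_divide_eq mult.commute)
      also have "\<dots> = k + 2 * \<theta> * (\<Sum>i<n. b i)"
        using \<theta>0 by (simp add: k_def field_simps power2_eq_square)
      also have "2 * \<theta> * (\<Sum>i<n. b i) = real (pulls n a \<omega>) / (real j + 1)"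
        unfolding N by (simp add: \<theta>_def divide_simps)
      finally show ?thesis .
    qed
    then show ?case unfolding y_def by blast
  qed
qed

lemma mean_est_minus:
  assumes "pulls t a \<omega> > 0"
  shows "mean_est m t a \<omega> - r =
    (\<Sum>i<t. of_bool (fst (\<omega> i) = a) * (snd (\<omega> i) - r)) / real (pulls t a \<omega>)"
proof -
  have "(\<Sum>i<t. of_bool (fst (\<omega> i) = a) * (snd (\<omega> i) - r)) =
      (\<Sum>i<t. of_bool (fst (\<omega> i) = a) * snd (\<omega> i)) - r * real (pulls t a \<omega>)"
    by (simp add: pulls_eq_sum algebra_simps sum_subtractf sum_distrib_left)
  then show ?thesis
    using assms
    by (simp add: mean_est_def sum.atLeast1_atMost_eq arm_def outcome_def field_simps)
qed

lemma mean_est_tendsto: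
  assumes N: "filterlim (\<lambda>t. pulls t a \<omega>) at_top sequentially"
    and bnd: "\<And>j::nat. \<exists>k. \<forall>n.
      \<bar>\<Sum>i<n. of_bool (fst (\<omega> i) = a) * (snd (\<omega> i) - r)\<bar> \<le> k + real (pulls n a \<omega>) / (real j + 1)"
  shows "(\<lambda>t. mean_est m t a \<omega>) \<longlonglongrightarrow> r"
proof (rule LIMSEQ_I)
  fix e :: real assume e: "0 < e"
  \<comment> \<open>One half of \<open>e\<close> pays for the slope \<open>1 / (real j + 1)\<close>.
    The other half pays for \<open>k\<close> once the number of pulls exceeds
    \<open>2 * \<bar>k\<bar> / e\<close>.\<close>
  obtain j :: nat where j: "2 / e < real j" using reals_Archimedean2 by blast
  obtain k where k: "\<And>n. \<bar>\<Sum>i<n. of_bool (fst (\<omega> i) = a) * (snd (\<omega> i) - r)\<bar> \<le>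
      k + real (pulls n a \<omega>) / (real j + 1)"
    using bnd by blast
  have je: "1 / (real j + 1) < e / 2"
    using j e by (simp add: field_simps)
  have "eventually (\<lambda>t. pulls t a \<omega> \<ge> nat \<lceil>2 * \<bar>k\<bar> / e\<rceil> + 1) sequentially"
    using N unfolding filterlim_at_top by blast
  then obtain t0 where t0: "\<And>t. t \<ge> t0 \<Longrightarrow> pulls t a \<omega> \<ge> nat \<lceil>2 * \<bar>k\<bar> / e\<rceil> + 1"
    unfolding eventually_sequentially by blast
  have "norm (mean_est m t a \<omega> - r) < e" if "t \<ge> t0" for t
  proof -
    let ?N = "real (pulls t a \<omega>)"
    have pos: "pulls t a \<omega> > 0" and "2 * \<bar>k\<bar> / e < ?N"
      using t0[OF that] by linarith+
    then have "k < e / 2 * ?N" using e by (simp add: field_simps)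
    moreover have "?N / (real j + 1) < e / 2 * ?N"
      using mult_strict_right_mono[OF je, of ?N] pos by simp
    ultimately have "k + ?N / (real j + 1) < e / 2 * ?N + e / 2 * ?N"
      by (rule add_strict_mono)
    then have "\<bar>\<Sum>i<t. of_bool (fst (\<omega> i) = a) * (snd (\<omega> i) - r)\<bar> < e * ?N"
      using k[of t] by simp
    then show ?thesis
      using pos by (simp add: mean_est_minus pos_divide_less_eq)
  qed
  then show "\<exists>t0. \<forall>t\<ge>t0. norm (mean_est m t a \<omega> - r) < e" by blast
qed

section \<open>Pathwise growth of the wealth of one arm\<close>

lemma mean_est_in_unit:
  assumes x: "\<And>i. snd (\<omega> i) \<in> {0..1}" and m: "m $ a \<in> {0..1}"
  shows "mean_est m t a \<omega> \<in> {0..1}"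
proof (cases "pulls t a \<omega> = 0")
  case False
  have "(\<Sum>i<t. of_bool (fst (\<omega> i) = a) * snd (\<omega> i)) \<le> real (pulls t a \<omega>)"
    unfolding pulls_eq_sum using x by (intro sum_mono) auto
  moreover have "0 \<le> (\<Sum>i<t. of_bool (fst (\<omega> i) = a) * snd (\<omega> i))"
    using x by (intro sum_nonneg) auto
  ultimately show ?thesis
    using False by (simp add: mean_est_def sum.atLeast1_atMost_eq arm_def outcome_def)
qed (use m in \<open>simp add: mean_est_def\<close>)

text \<open>The product equals \<open>(1 - m) * u * x + m * (1 - u) * (1 - x) - m * (1 - m)\<close>,
  and \<open>m * (1 - m)\<close> is at most 1/4. Hence \<open>c > 1 / 4\<close> keeps every betting
  factor positive.\<close>

lemma mult_diff_unit_ge: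
  fixes u x m :: real
  assumes "u \<in> {0..1}" "x \<in> {0..1}" "m \<in> {0..1}"
  shows "- (1 / 4) \<le> (u - m) * (x - m)"
proof -
  have "0 \<le> (1 - m) * (u * x) + m * ((1 - u) * (1 - x))"
    using assms by simp
  moreover have "0 \<le> (m - 1 / 2)\<^sup>2" by simp
  ultimately show ?thesis by (simp add: power2_eq_square algebra_simps)
qed

lemma bet_factor_pos:
  fixes u x m c :: real
  assumes "u \<in> {0..1}" "x \<in> {0..1}" "m \<in> {0..1}" and c: "c > 1 / 4"
  shows "0 < 1 + (u - m) * (x - m) / c"
proof -
  have "- c < (u - m) * (x - m)"
    using mult_diff_unit_ge[OF assms(1-3)] c by linarith
  then show ?thesis using c by (simp add: field_simps)
qed

text \<open>Concavity of \<open>ln\<close>, via its tangent at \<open>f x\<close>: since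
  \<open>f\<close> is affine, weighting the tangent bounds at 0 and 1 by \<open>1 - x\<close> and
  \<open>x\<close> cancels the linear terms. A bound affine in the outcome lets the law of large
  numbers for outcomes control the log-wealth.\<close>

lemma ln_bet_factor_ge_chord:
  fixes u x m c :: real
  assumes u: "u \<in> {0..1}" and x: "x \<in> {0..1}" and m: "m \<in> {0..1}" and c: "c > 1 / 4"
  shows "(1 - x) * ln (1 + (u - m) * (0 - m) / c) + x * ln (1 + (u - m) * (1 - m) / c)
    \<le> ln (1 + (u - m) * (x - m) / c)"
proof -
  define f where "f y = 1 + (u - m) * (y - m) / c" for y
  have pos: "0 < f y" if "y \<in> {0..1}" for y
    unfolding f_def by (rule bet_factor_pos[OF u that m c])
  have tangent: "ln (f y) \<le> ln (f x) + (f y / f x - 1)" if "y \<in> {0..1}" for y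
    using ln_le_minus_one[of "f y / f x"] pos[OF that] pos[OF x] by (simp add: ln_div)
  have "(1 - x) * ln (f 0) + x * ln (f 1) \<le>
      (1 - x) * (ln (f x) + (f 0 / f x - 1)) + x * (ln (f x) + (f 1 / f x - 1))"
    using x by (intro add_mono mult_left_mono tangent) auto
  also have "\<dots> = ln (f x) + ((1 - x) * f 0 + x * f 1) / f x - 1"
    by (simp only: add_divide_distrib diff_divide_distrib ring_distribs) simp
  also have "(1 - x) * f 0 + x * f 1 = f x"
    by (simp add: f_def field_simps add_divide_distrib diff_divide_distrib)
  finally show ?thesis
    using pos[OF x] by (simp add: f_def)
qed

text \<open>The growth rate of the limiting bet against a Bernoulli arm, bounded by \<open>1 - 1 / y \<le> ln y\<close>:
  positivity amounts to \<open>m * (1 - m) < c\<close>.\<close>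

lemma growth_rate_pos:
  fixes r m c :: real
  assumes r: "r \<in> {0..1}" and m: "m \<in> {0..1}" and c: "c > 1 / 4" and ne: "m \<noteq> r"
  shows "0 < (1 - r) * ln (1 + (r - m) * (0 - m) / c) + r * ln (1 + (r - m) * (1 - m) / c)"
proof -
  define A where "A = 1 + (r - m) * (0 - m) / c"
  define B where "B = 1 + (r - m) * (1 - m) / c"
  have A: "0 < A" and B: "0 < B"
    unfolding A_def B_def using r m c by (intro bet_factor_pos; simp)+
  have lower: "1 - 1 / y \<le> ln y" if "0 < y" for y :: real
    using ln_le_minus_one[of "1 / y"] that by (simp add: ln_div)
  have "0 \<le> (m - 1 / 2)\<^sup>2" by simp
  then have "m * (1 - m) < c" using c by (simp add: power2_eq_square algebra_simps)
  \<comment> \<open>This is the numerator of \<open>(1 - r) * (1 - 1 / A) + r * (1 - 1 / B)\<close>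
    over the common denominator \<open>A * B\<close>.\<close>
  then have "0 < (r - m)\<^sup>2 * (c - m * (1 - m)) / c\<^sup>2"
    using ne c by (intro divide_pos_pos mult_pos_pos) auto
  also have "\<dots> = A * B - (1 - r) * B - r * A"
    using c by (simp add: A_def B_def field_simps power2_eq_square)
  finally have "0 < (A * B - (1 - r) * B - r * A) / (A * B)"
    using A B by simp
  also have "\<dots> = (1 - r) * (1 - 1 / A) + r * (1 - 1 / B)"
    using A B by (simp add: field_simps)
  also have "\<dots> \<le> (1 - r) * ln A + r * ln B"
    using r A B by (intro add_mono mult_left_mono lower) auto
  finally show ?thesis by (simp add: A_def B_def)
qed

text \<open>Up to a constant, the log-wealth is eventually at least \<open>g / 2\<close> per pull,
  where \<open>g\<close> is the growth rate at the limiting estimate \<open>r\<close>.\<close>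

lemma arm_wealth_at_top:
  assumes c: "c > 1 / 4" and r: "r \<in> {0..1}" and m: "m $ a \<in> {0..1}" and ne: "m $ a \<noteq> r"
    and x: "\<And>i. snd (\<omega> i) \<in> {0..1}"
    and N: "filterlim (\<lambda>t. pulls t a \<omega>) at_top sequentially"
    and lim: "(\<lambda>t. mean_est m t a \<omega>) \<longlonglongrightarrow> r"
  shows "filterlim (\<lambda>t. arm_wealth c m t a \<omega>) at_top sequentially"
proof -
  define u where "u t = mean_est m t a \<omega>" for t
  define b :: "nat \<Rightarrow> real" where "b i = of_bool (fst (\<omega> i) = a)" for i
  define X where "X i = snd (\<omega> i)" for i
  define L where "L y v = ln (1 + (v - m $ a) * (y - m $ a) / c)" for y v
  have u: "u t \<in> {0..1}" for t
    unfolding u_def by (rule mean_est_in_unit[OF x m])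
  have X: "X i \<in> {0..1}" for i unfolding X_def by (rule x)
  have b: "b i = 0 \<or> b i = 1" for i by (simp add: b_def)
  have ulim: "u \<longlonglongrightarrow> r" using lim by (simp add: u_def[abs_def])
  have Nb: "real (pulls t a \<omega>) = (\<Sum>i<t. b i)" for t by (simp add: pulls_eq_sum b_def)
  \<comment> \<open>The factor at time \<open>i + 1\<close> uses coordinate \<open>i\<close> and the
    estimate from the first \<open>i\<close> observations, so both carry index \<open>i\<close>
    here.\<close>
  have wealth: "arm_wealth c m t a \<omega> = exp (\<Sum>i<t. b i * L (X i) (u i))" for t
  proof -
    have "1 - b i + b i * (1 + (u i - m $ a) * (X i - m $ a) / c) = exp (b i * L (X i) (u i))" for i
      using b[of i] bet_factor_pos[OF u[of i] X[of i] m c] by (auto simp: L_def)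
    then show ?thesis
      by (simp add: arm_wealth_def prod.atLeast1_atMost_eq exp_sum arm_def outcome_def
          flip: b_def u_def X_def)
  qed
  have Llim: "(\<lambda>i. L y (u i)) \<longlonglongrightarrow> L y r" if "y \<in> {0..1}" for y
  proof -
    have "(\<lambda>i. 1 + (u i - m $ a) * (y - m $ a) / c) \<longlonglongrightarrow> 1 + (r - m $ a) * (y - m $ a) / c"
      using c by (intro tendsto_intros ulim) simp
    then show ?thesis
      unfolding L_def using bet_factor_pos[OF r that m c] by (intro tendsto_ln) simp_all
  qed
  define g where "g = (1 - r) * L 0 r + r * L 1 r"
  have g: "0 < g"
    using growth_rate_pos[OF r m c ne] by (simp add: g_def L_def)
  \<comment> \<open>The chord for the limiting bet \<open>r\<close>, lowered by \<open>g / 4\<close>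
    to absorb the error of replacing \<open>u i\<close> by \<open>r\<close>.\<close>
  define D where "D i = (1 - X i) * L 0 r + X i * L 1 r - g / 4" for i
  have "\<forall>\<^sub>F i in sequentially. L 0 (u i) > L 0 r - g / 4"
    using g by (intro order_tendstoD(1)[OF Llim]) auto
  moreover have "\<forall>\<^sub>F i in sequentially. L 1 (u i) > L 1 r - g / 4"
    using g by (intro order_tendstoD(1)[OF Llim]) auto
  ultimately have "\<forall>\<^sub>F i in sequentially. b i * D i \<le> b i * L (X i) (u i)"
  proof eventually_elim
    case (elim i)
    have "D i = (1 - X i) * (L 0 r - g / 4) + X i * (L 1 r - g / 4)"
      unfolding D_def by algebra
    also have "\<dots> \<le> (1 - X i) * L 0 (u i) + X i * L 1 (u i)"
      using X[of i] elim(1,2)[THEN less_imp_le] by (intro add_mono mult_left_mono) simp_all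
    also have "\<dots> \<le> L (X i) (u i)"
      unfolding L_def using ln_bet_factor_ge_chord[OF u[of i] X[of i] m c] .
    finally show ?case using b[of i] by (elim disjE) simp_all
  qed
  then obtain i0 where i0: "\<And>i. i \<ge> i0 \<Longrightarrow> b i * D i \<le> b i * L (X i) (u i)"
    unfolding eventually_sequentially by blast
  \<comment> \<open>Collects the finitely many early terms where the comparison with
    \<open>D\<close> may fail.\<close>
  define C where "C = (\<Sum>i<i0. b i * D i - b i * L (X i) (u i))"
  have tail: "(\<Sum>i<t. b i * D i) - C \<le> (\<Sum>i<t. b i * L (X i) (u i))" if "t \<ge> i0" for t
  proof -
    have "(\<Sum>i<t. b i * D i - b i * L (X i) (u i)) =
        C + (\<Sum>i=i0..<t. b i * D i - b i * L (X i) (u i))"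
      unfolding C_def lessThan_atLeast0 using that by (intro sum.atLeastLessThan_concat[symmetric]) auto
    also have "\<dots> \<le> C + 0"
      using i0 by (intro add_left_mono sum_nonpos) auto
    finally show ?thesis by (simp add: sum_subtractf)
  qed
  have "(\<lambda>t. (1 - u t) * L 0 r + u t * L 1 r) \<longlonglongrightarrow> g"
    unfolding g_def by (intro tendsto_intros ulim)
  \<comment> \<open>The threshold \<open>3 / 4\<close> leaves \<open>g / 2\<close> after the loss of
    \<open>g / 4\<close> built into \<open>D\<close>.\<close>
  then have "\<forall>\<^sub>F t in sequentially. (1 - u t) * L 0 r + u t * L 1 r > g * (3 / 4)"
    using g by (intro order_tendstoD(1)) auto
  moreover have "\<forall>\<^sub>F t in sequentially. pulls t a \<omega> \<ge> 1"
    using N unfolding filterlim_at_top by blast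
  moreover have "\<forall>\<^sub>F t in sequentially. t \<ge> i0" by (rule eventually_ge_at_top)
  ultimately have "\<forall>\<^sub>F t in sequentially.
      real (pulls t a \<omega>) * (g / 2) - C \<le> (\<Sum>i<t. b i * L (X i) (u i))"
  proof eventually_elim
    case (elim t)
    let ?N = "real (pulls t a \<omega>)"
    \<comment> \<open>The estimate that sets the bets is also the average outcome of the arm, so the
      sum of the affine bounds is the number of pulls times their value at
      \<open>u t\<close>.\<close>
    have "u t * ?N = (\<Sum>i<t. b i * X i)"
      using elim(2) by (simp add: u_def mean_est_def sum.atLeast1_atMost_eq arm_def outcome_def b_def X_def)
    moreover have "b i * D i = b i * (L 0 r - g / 4) + b i * X i * (L 1 r - L 0 r)" for i
      unfolding D_def by algebra
    ultimately have "(\<Sum>i<t. b i * D i) = ?N * (L 0 r - g / 4) + u t * ?N * (L 1 r - L 0 r)"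
      unfolding Nb by (simp add: sum.distrib flip: sum_distrib_right)
    also have "\<dots> = ?N * ((1 - u t) * L 0 r + u t * L 1 r - g / 4)"
      by algebra
    finally have "(\<Sum>i<t. b i * D i) = ?N * ((1 - u t) * L 0 r + u t * L 1 r - g / 4)" .
    moreover have "?N * (g / 2) \<le> ?N * ((1 - u t) * L 0 r + u t * L 1 r - g / 4)"
      using elim(1) by (intro mult_left_mono) auto
    ultimately show ?case using tail[OF elim(3)] by linarith
  qed
  moreover have "filterlim (\<lambda>t. real (pulls t a \<omega>) * (g / 2) - C) at_top sequentially"
    using filterlim_tendsto_add_at_top[OF tendsto_const[of "- C"]
        filterlim_at_top_mult_tendsto_pos[OF tendsto_const[of "g / 2"] _
          filterlim_compose[OF filterlim_real_sequentially N]]] g by simp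
  ultimately have "filterlim (\<lambda>t. \<Sum>i<t. b i * L (X i) (u i)) at_top sequentially"
    by (rule filterlim_at_top_mono[rotated])
  then show ?thesis
    unfolding wealth by (rule filterlim_compose[OF exp_at_top])
qed

lemma arm_wealth_nonneg:
  assumes c: "c > 1 / 4" and m: "m $ a \<in> {0..1}" and x: "\<And>i. snd (\<omega> i) \<in> {0..1}"
  shows "0 \<le> arm_wealth c m t a \<omega>"
  unfolding arm_wealth_def
proof (rule prod_nonneg)
  fix i
  have "0 < 1 + (mean_est m (i - 1) a \<omega> - m $ a) * (outcome i \<omega> - m $ a) / c"
    using x by (intro bet_factor_pos mean_est_in_unit m c) (auto simp: outcome_def)
  then show "0 \<le> 1 - of_bool (arm i \<omega> = a) + of_bool (arm i \<omega> = a) *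
      (1 + (mean_est m (i - 1) a \<omega> - m $ a) * (outcome i \<omega> - m $ a) / c)"
    by auto
qed

section \<open>From diverging wealth to rejection with probability one\<close>

lemma seq_test_rejects_iff:
  "(\<exists>t\<ge>1. seq_test c m \<alpha> t \<omega> = 1) \<longleftrightarrow> (\<exists>t\<ge>1. 1 / \<alpha> \<le> e_process c m t \<omega>)"
proof -
  have "seq_test c m \<alpha> t \<omega> = 1 \<longleftrightarrow> (\<exists>i\<in>{1..t}. 1 / \<alpha> \<le> e_process c m i \<omega>)" if "t \<ge> 1" for t
    using that by (simp add: seq_test_def Max_ge_iff)
  moreover have "t \<in> {1..t}" if "t \<ge> 1" for t :: nat
    using that by simp
  ultimately show ?thesis
    by (metis atLeastAtMost_iff)
qed

lemma measurable_e_process: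
  fixes m :: "real ^ 'w::finite"
  shows "e_process c m t \<in> borel_measurable (PiM UNIV (\<lambda>_. obs_space))"
proof -
  have [measurable]: "arm i \<in> measurable (PiM UNIV (\<lambda>_. obs_space)) (count_space (UNIV :: 'w set))" for i
    unfolding arm_def[abs_def] by measurable
  have [measurable]: "outcome i \<in> borel_measurable (PiM UNIV (\<lambda>_. obs_space :: ('w \<times> real) measure))" for i
    unfolding outcome_def[abs_def] by measurable
  have [measurable]: "pulls i a \<in> measurable (PiM UNIV (\<lambda>_. obs_space)) (count_space UNIV)" for i and a :: 'w
    unfolding pulls_def[abs_def] by measurable
  show ?thesis
    unfolding e_process_def[abs_def] arm_wealth_def mean_est_def by measurable
qed

text \<open>Point masses at the means are a witness. The infimum of a constant over the family is
  that constant once the family is nonempty.\<close>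

lemma arm_dists_nonempty:
  fixes \<mu> :: "real ^ 'w::finite"
  assumes "\<forall>a. \<mu> $ a \<in> {0..1}"
  shows "arm_dists \<mu> \<noteq> {}"
proof -
  have "(\<lambda>a. return borel (\<mu> $ a)) \<in> arm_dists \<mu>"
    using assms by (auto simp: arm_dists_def prob_space_return integral_return)
  then show ?thesis by blast
qed

theorem theorem4:
  fixes \<mu> m :: "real ^ 'w::finite"
    and \<alpha> c :: real
    and \<pi> :: "nat \<Rightarrow> 'w path \<Rightarrow> 'w pmf"
  assumes "0 < \<alpha>" and "\<alpha> < 1" and "c > 1 / 4"
    and "\<forall>a. \<mu> $ a \<in> {0..1}" and "\<forall>a. m $ a \<in> {0..1}" and "m \<noteq> \<mu>"
    and "sampling_scheme \<pi>"
    and "\<forall>P \<in> arm_dists \<mu>. AE \<omega> in data_law \<pi> P.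
           \<exists>a \<in> {a. m $ a \<noteq> \<mu> $ a}. filterlim (\<lambda>t. pulls t a \<omega>) at_top sequentially"
  shows "(INF P \<in> arm_dists \<mu>.
            measure (data_law \<pi> P)
              {\<omega> \<in> space (data_law \<pi> P). \<exists>t\<ge>1. seq_test c m \<alpha> t \<omega> = 1}) = 1"
proof -
  have "measure (data_law \<pi> P) {\<omega> \<in> space (data_law \<pi> P). \<exists>t\<ge>1. seq_test c m \<alpha> t \<omega> = 1} = 1"
    if P: "P \<in> arm_dists \<mu>" for P
  proof -
    interpret prob_space "data_law \<pi> P" by (rule prob_space_data_law[OF assms(7) P])
    note [measurable_cong] = sets_data_law[OF assms(7) P]
    note [measurable] = measurable_e_process
    have "AE \<omega> in data_law \<pi> P. \<forall>a. \<forall>j::nat. \<exists>k. \<forall>n.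
        \<bar>\<Sum>i<n. of_bool (fst (\<omega> i) = a) * (snd (\<omega> i) - \<mu> $ a)\<bar> \<le> k + real (pulls n a \<omega>) / (real j + 1)"
      using AE_centred_sum_bound[OF assms(7) P] assms(4) by (subst AE_all_countable) blast
    then have "AE \<omega> in data_law \<pi> P. \<exists>t\<ge>1. seq_test c m \<alpha> t \<omega> = 1"
      using AE_outcomes_in_unit[OF assms(7) P] assms(8)[rule_format, OF P]
    proof eventually_elim
      case (elim \<omega>)
      then obtain a where a: "m $ a \<noteq> \<mu> $ a"
        and N: "filterlim (\<lambda>t. pulls t a \<omega>) at_top sequentially" by blast
      have x: "snd (\<omega> i) \<in> {0..1}" for i using elim(2) by blast
      have "filterlim (\<lambda>t. arm_wealth c m t a \<omega>) at_top sequentially"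
        using assms(3-5) a x N elim(1)
        by (intro arm_wealth_at_top[where r="\<mu> $ a"] mean_est_tendsto) auto
      \<comment> \<open>Averaging divides by the number of arms, and the other wealths are
        nonnegative, so one arm reaching \<open>CARD('w) / \<alpha>\<close> suffices.\<close>
      then have "\<forall>\<^sub>F t in sequentially. real CARD('w) * (1 / \<alpha>) \<le> arm_wealth c m t a \<omega>"
        unfolding filterlim_at_top by blast
      then have "\<forall>\<^sub>F t in sequentially. t \<ge> 1 \<and> real CARD('w) * (1 / \<alpha>) \<le> arm_wealth c m t a \<omega>"
        using eventually_ge_at_top by (rule eventually_conj[rotated])
      then obtain t where t: "t \<ge> 1" "real CARD('w) * (1 / \<alpha>) \<le> arm_wealth c m t a \<omega>"
        by (auto dest: eventually_happens)
      have "arm_wealth c m t a \<omega> \<le> (\<Sum>a\<in>UNIV. arm_wealth c m t a \<omega>)"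
        using assms(3,5) x by (intro member_le_sum arm_wealth_nonneg) auto
      with t(2) have "1 / \<alpha> \<le> e_process c m t \<omega>"
        by (simp add: e_process_def field_simps)
      then show ?case unfolding seq_test_rejects_iff using t(1) by (intro exI[of _ t] conjI)
    qed
    then show ?thesis
      unfolding seq_test_rejects_iff by (subst prob_Collect_eq_1) measurable
  qed
  then show ?thesis
    using arm_dists_nonempty[OF assms(4)] by simp
qed

end
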